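(* Let $s\ge 2$ be an integer. Then, as $n\to\infty$ (with $s$ fixed), $$\mathrm{exco}_2(n,M_s^3)=(s-1)n^3(1+o(1)).$$
   Context: $M_s^3$ is the $3$-uniform matching of size $s$, i.e. the $3$-uniform hypergraph on $3s$ vertices with $s$ pairwise disjoint edges. A $3$-uniform hypergraph is $H$-free if it contains no (not necessarily induced) copy of $H$ as a subhypergraph. For a $3$-uniform hypergraph $G$ and distinct vertices $x,y$, $d_G(x,y)$ is the number of edges containing both $x$ and $y$, and $\mathrm{co}_2(G)=\sum_{\{x,y\}\in\binom{V(G)}{2}}d_G(x,y)^2$. $\mathrm{exco}_2(n,H)$ is the maximum of $\mathrm{co}_2(G)$ over all $H$-free $3$-uniform hypergraphs $G$ on $n$ vertices. *)

theory Defs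
  imports "HOL-Library.Landau_Symbols"
begin

type_synonym 'a hypergraph = "'a set \<times> 'a set set"

abbreviation verts :: "'a hypergraph \<Rightarrow> 'a set" where
  "verts G \<equiv> fst G"

abbreviation edges :: "'a hypergraph \<Rightarrow> 'a set set" where
  "edges G \<equiv> snd G"

definition three_uniform :: "'a hypergraph \<Rightarrow> bool" where
  "three_uniform G \<longleftrightarrow> finite (verts G) \<and> (\<forall>e\<in>edges G. e \<subseteq> verts G \<and> card e = 3)"

definition contains_copy :: "'a hypergraph \<Rightarrow> 'b hypergraph \<Rightarrow> bool" where
  "contains_copy G H \<longleftrightarrow>
     (\<exists>f. inj_on f (verts H) \<and> f ` verts H \<subseteq> verts G \<and> (\<forall>e\<in>edges H. f ` e \<in> edges G))"

definition hfree :: "'b hypergraph \<Rightarrow> 'a hypergraph \<Rightarrow> bool" where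
  "hfree H G \<longleftrightarrow> \<not> contains_copy G H"

definition codegree :: "'a hypergraph \<Rightarrow> 'a \<Rightarrow> 'a \<Rightarrow> nat" where
  "codegree G x y = card {e \<in> edges G. x \<in> e \<and> y \<in> e}"

definition pair_degree :: "'a hypergraph \<Rightarrow> 'a set \<Rightarrow> nat" where
  "pair_degree G p = card {e \<in> edges G. p \<subseteq> e}"

lemma pair_degree_eq_codegree: "pair_degree G {x, y} = codegree G x y"
  by (simp add: pair_degree_def codegree_def)

text \<open>The sum ranges over unordered pairs, so each pair is counted once.\<close>

definition co2 :: "'a hypergraph \<Rightarrow> nat" where
  "co2 G = (\<Sum>p | p \<subseteq> verts G \<and> card p = 2. (pair_degree G p)\<^sup>2)"

definition matching3 :: "nat \<Rightarrow> nat hypergraph" where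
  "matching3 s = ({..<3 * s}, (\<lambda>i. {3 * i, 3 * i + 1, 3 * i + 2}) ` {..<s})"

text \<open>
  Vertices are taken to be natural numbers; every finite hypergraph is isomorphic to such a one.
  The set of values is always finite (\<open>finite_co2_values\<close>); it is empty, and the maximum
  is then unspecified, only if no \<open>H\<close>-free hypergraph on \<open>n\<close> vertices exists, which
  does not happen when \<open>H\<close> has an edge (\<open>co2_values_nonempty\<close>).
\<close>

definition co2_values :: "nat \<Rightarrow> 'b hypergraph \<Rightarrow> nat set" where
  "co2_values n H =
     {co2 G | G :: nat hypergraph. three_uniform G \<and> card (verts G) = n \<and> hfree H G}"

definition exco2 :: "nat \<Rightarrow> 'b hypergraph \<Rightarrow> nat" where
  "exco2 n H = Max (co2_values n H)"

lemma three_uniform_matching3: "three_uniform (matching3 s)"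
  by (auto simp: three_uniform_def matching3_def)

lemma co2_le:
  assumes "three_uniform G" "card (verts G) = n"
  shows "co2 G \<le> 2 ^ n * (2 ^ n)\<^sup>2"
proof -
  have fin: "finite (Pow (verts G))" and cP: "card (Pow (verts G)) = 2 ^ n"
    using assms by (auto simp: three_uniform_def card_Pow)
  have "pair_degree G p \<le> 2 ^ n" for p
    unfolding pair_degree_def cP[symmetric]
    using assms fin by (intro card_mono) (auto simp: three_uniform_def)
  then have "co2 G \<le> (\<Sum>p | p \<subseteq> verts G \<and> card p = 2. (2 ^ n)\<^sup>2)"
    unfolding co2_def by (intro sum_mono power_mono) auto
  also have "\<dots> = card {p. p \<subseteq> verts G \<and> card p = 2} * (2 ^ n)\<^sup>2"
    by simp
  also have "card {p. p \<subseteq> verts G \<and> card p = 2} \<le> 2 ^ n"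
    unfolding cP[symmetric] using fin by (intro card_mono) auto
  finally show ?thesis by simp
qed

lemma finite_co2_values: "finite (co2_values n H)"
  by (rule finite_subset[of _ "{..2 ^ n * (2 ^ n)\<^sup>2}"])
     (auto simp: co2_values_def simp del: power_mult_distrib intro!: co2_le[simplified])

lemma co2_values_nonempty:
  assumes "edges H \<noteq> {}"
  shows "co2_values n H \<noteq> {}"
proof -
  have "three_uniform ({..<n}, {})" "hfree H ({..<n}, {})"
    using assms by (auto simp: three_uniform_def hfree_def contains_copy_def)
  then have "co2 ({..<n}, {}) \<in> co2_values n H"
    unfolding co2_values_def by (intro CollectI exI[of _ "({..<n}, {})"]) auto
  then show ?thesis by blast
qed

end

theory Submission
  imports Defs "HOL-Real_Asymp.Real_Asymp"
begin

text \<open>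
  An asymptotically extremal hypergraph consists of all triples that meet a fixed set \<open>S\<close> of \<open>s - 1\<close> vertices.
  Disjoint edges use different vertices of \<open>S\<close>, so it has no \<open>s\<close> disjoint edges, and each of the
  about \<open>(s - 1) n\<close> pairs with exactly one vertex in \<open>S\<close> has codegree \<open>n - 2\<close>
  (\<open>co2_edges_meeting\<close>).

  For the upper bound let \<open>G\<close> have no \<open>s\<close> disjoint edges. The vertices of a maximal matching form a
  set \<open>C\<close> of fewer than \<open>3 s\<close> vertices that meets every edge. A pair outside \<open>C\<close> extends to an edge only
  by a vertex of \<open>C\<close>, so its codegree is bounded and all such pairs together contribute \<open>O(n\<^sup>2)\<close>.
  It remains to bound \<open>f c = (\<Sum>y. (d c y)\<^sup>2)\<close> for each \<open>c\<close> in \<open>C\<close>. Since codegrees are at most \<open>n\<close>,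
  always \<open>f c \<le> n\<^sup>3\<close>, but also \<open>f c \<le> n * (\<Sum>y. d c y)\<close>, which is \<open>2 n\<close> times the degree of \<open>c\<close>.
  Hence a vertex of degree \<open>O(n)\<close> contributes only \<open>O(n\<^sup>2)\<close>. On the other hand, at most \<open>s - 1\<close>
  vertices can have degree above \<open>4 s n\<close>: from \<open>s\<close> of them one could greedily choose \<open>s\<close> disjoint
  edges, because only \<open>O(n)\<close> edges at a vertex meet a given bounded set
  (\<open>matching_from_heavy_vertices\<close>). So the cubic term is at most \<open>(s - 1) n\<^sup>3\<close>
  (\<open>co2_le_of_matching_free\<close>).
\<close>

section \<open>Matchings as sets of pairwise disjoint edges\<close>

text \<open>
  The concrete vertex numbering of \<^term>\<open>matching3\<close> matters only here. An embedding restricts to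
  the blocks \<open>{3 i, 3 i + 1, 3 i + 2}\<close>; conversely, \<open>s\<close> disjoint edges are enumerated block by block,
  where \<open>x div 3\<close> selects the edge and \<open>x mod 3\<close> the vertex inside it.
\<close>

lemma contains_matching3_iff:
  assumes G: "three_uniform G"
  shows "contains_copy G (matching3 s) \<longleftrightarrow>
    (\<exists>M. M \<subseteq> edges G \<and> pairwise disjnt M \<and> finite M \<and> card M = s)"
proof
  assume "contains_copy G (matching3 s)"
  then obtain f where inj: "inj_on f {..<3 * s}"
    and ed: "\<And>i. i < s \<Longrightarrow> f ` {3 * i, 3 * i + 1, 3 * i + 2} \<in> edges G"
    by (auto simp: contains_copy_def matching3_def)
  define g where "g i = f ` {3 * i, 3 * i + 1, 3 * i + 2}" for i
  have disj: "disjnt (g i) (g j)" if "i < s" "j < s" "i \<noteq> j" for i j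
  proof -
    have "g i \<inter> g j = f ` ({3 * i, 3 * i + 1, 3 * i + 2} \<inter> {3 * j, 3 * j + 1, 3 * j + 2})"
      unfolding g_def using that by (intro inj_on_image_Int[OF inj, symmetric]) auto
    also have "{3 * i, 3 * i + 1, 3 * i + 2} \<inter> {3 * j, 3 * j + 1, 3 * j + 2} = {}"
      using that(3) by auto
    finally show ?thesis by (simp add: disjnt_def)
  qed
  have "inj_on g {..<s}"
  proof (rule inj_onI)
    fix i j assume ij: "i \<in> {..<s}" "j \<in> {..<s}" "g i = g j"
    show "i = j"
    proof (rule ccontr)
      assume "i \<noteq> j"
      with disj[of i j] ij have "g i = {}" by (auto simp: disjnt_def)
      then show False by (simp add: g_def)
    qed
  qed
  then have "card (g ` {..<s}) = s" by (simp add: card_image)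
  moreover have "pairwise disjnt (g ` {..<s})"
    using disj by (force simp: pairwise_def)
  moreover have "g ` {..<s} \<subseteq> edges G" using ed by (auto simp: g_def)
  ultimately show "\<exists>M. M \<subseteq> edges G \<and> pairwise disjnt M \<and> finite M \<and> card M = s"
    by blast
next
  assume "\<exists>M. M \<subseteq> edges G \<and> pairwise disjnt M \<and> finite M \<and> card M = s"
  then obtain M where M: "M \<subseteq> edges G" "pairwise disjnt M" "finite M" "card M = s" by blast
  obtain g where g: "bij_betw g {..<s} M"
    using ex_bij_betw_nat_finite[OF M(3)] M(4) by (auto simp: atLeast0LessThan)
  have "\<exists>h. bij_betw h {..<3::nat} e" if "e \<in> M" for e
  proof -
    have "card e = 3" using that M(1) G by (auto simp: three_uniform_def)
    moreover from this have "finite e" by (intro card_ge_0_finite) simp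
    ultimately show ?thesis using ex_bij_betw_nat_finite[of e] by (auto simp: atLeast0LessThan)
  qed
  then obtain h where h: "\<And>e. e \<in> M \<Longrightarrow> bij_betw (h e) {..<3::nat} e" by metis
  define f where "f x = h (g (x div 3)) (x mod 3)" for x
  have gM: "g i \<in> M" if "i < s" for i using g that by (auto simp: bij_betw_def)
  have fin: "f x \<in> g (x div 3)" if "x < 3 * s" for x
    using bij_betwE[OF h[OF gM, of "x div 3"]] that by (auto simp: f_def)
  have "inj_on f {..<3 * s}"
  proof (rule inj_onI)
    fix x y assume xy: "x \<in> {..<3 * s}" "y \<in> {..<3 * s}" "f x = f y"
    have lt: "x div 3 < s" "y div 3 < s" using xy by auto
    have "\<not> disjnt (g (x div 3)) (g (y div 3))"
      using fin[of x] fin[of y] xy by (auto simp: disjnt_def)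
    then have "g (x div 3) = g (y div 3)" using M(2) gM lt by (auto simp: pairwise_def)
    then have div: "x div 3 = y div 3" using g lt by (auto simp: bij_betw_def inj_on_def)
    then have "x mod 3 = y mod 3"
      using xy(3) h[OF gM[OF lt(1)]] by (auto simp: f_def bij_betw_def inj_on_def)
    with div show "x = y" by (metis div_mult_mod_eq)
  qed
  moreover have img: "f ` {3 * i, 3 * i + 1, 3 * i + 2} \<in> edges G" if "i < s" for i
  proof -
    have "(3 * i + 1) div 3 = i" "(3 * i + 2) div 3 = i" "(3 * i + 1) mod 3 = 1"
      "(3 * i + 2) mod 3 = 2" by presburger+
    then have "f ` {3 * i, 3 * i + 1, 3 * i + 2} = h (g i) ` {0, 1, 2}"
      by (simp only: f_def image_insert image_empty) simp
    also have "{0, 1, 2} = {..<3::nat}" by auto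
    also have "h (g i) ` {..<3} = g i" using h[OF gM[OF that]] by (simp add: bij_betw_def)
    finally show ?thesis using gM[OF that] M(1) by auto
  qed
  moreover have "f ` {..<3 * s} \<subseteq> verts G"
  proof (rule image_subsetI)
    fix x assume x: "x \<in> {..<3 * s}"
    then have "g (x div 3) \<in> edges G" using gM[of "x div 3"] M(1) by auto
    then show "f x \<in> verts G" using fin[of x] x G by (auto simp: three_uniform_def)
  qed
  ultimately show "contains_copy G (matching3 s)"
    by (auto simp: contains_copy_def matching3_def)
qed

section \<open>Degrees\<close>

definition vertex_degree :: "'a hypergraph \<Rightarrow> 'a \<Rightarrow> nat" where
  "vertex_degree G v = card {e \<in> edges G. v \<in> e}"

lemma finite_edges: "three_uniform G \<Longrightarrow> finite (edges G)"
  by (rule finite_subset[of _ "Pow (verts G)"]) (auto simp: three_uniform_def)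

lemma card_3_superset_eq_insert:
  assumes "card e = 3" "p \<subseteq> e" "card p = 2" "c \<in> e" "c \<notin> p"
  shows "e = insert c p"
proof -
  have "finite e" "finite p" using assms by (auto intro: card_ge_0_finite)
  then show ?thesis using assms by (intro card_subset_eq[symmetric]) auto
qed

text \<open>
  An edge through a pair is determined by its third vertex, so any set \<open>C\<close> that contains all
  possible third vertices bounds the codegree. It is used both with \<open>C\<close> the whole vertex set and
  with \<open>C\<close> a small vertex cover disjoint from the pair.
\<close>

lemma pair_degree_le:
  assumes G: "three_uniform G" and p: "card p = 2" and "finite C"
    and cover: "\<And>e. e \<in> edges G \<Longrightarrow> p \<subseteq> e \<Longrightarrow> \<exists>c\<in>C. c \<in> e \<and> c \<notin> p"
  shows "pair_degree G p \<le> card C"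
proof -
  have "{e \<in> edges G. p \<subseteq> e} \<subseteq> (\<lambda>c. insert c p) ` C"
  proof
    fix e assume e: "e \<in> {e \<in> edges G. p \<subseteq> e}"
    then obtain c where c: "c \<in> C" "c \<in> e" "c \<notin> p" using cover by blast
    moreover have "e = insert c p"
      using e G p c by (intro card_3_superset_eq_insert) (auto simp: three_uniform_def)
    ultimately show "e \<in> (\<lambda>c. insert c p) ` C" by blast
  qed
  then show ?thesis unfolding pair_degree_def using \<open>finite C\<close> by (rule surj_card_le[rotated])
qed

lemma pair_degree_le_card_verts:
  assumes G: "three_uniform G" and p: "card p = 2"
  shows "pair_degree G p \<le> card (verts G)"
proof (rule pair_degree_le[OF G p])
  show "finite (verts G)" using G by (simp add: three_uniform_def)
  fix e assume e: "e \<in> edges G" "p \<subseteq> e"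
  then have "p \<noteq> e" and "e \<subseteq> verts G" using G p by (auto simp: three_uniform_def)
  with e show "\<exists>c\<in>verts G. c \<in> e \<and> c \<notin> p" by blast
qed

text \<open>Double counting: every edge at \<open>v\<close> contains exactly two further vertices \<open>y\<close>.\<close>

lemma sum_pair_degree:
  assumes G: "three_uniform G"
  shows "(\<Sum>y\<in>verts G - {v}. pair_degree G {v, y}) = 2 * vertex_degree G v"
proof -
  have "(\<Sum>y\<in>verts G - {v}. card {e \<in> {e \<in> edges G. v \<in> e}. y \<in> e})
      = 2 * card {e \<in> edges G. v \<in> e}"
  proof (rule sum_multicount)
    show "\<forall>e\<in>{e \<in> edges G. v \<in> e}. card {y \<in> verts G - {v}. y \<in> e} = 2"
    proof
      fix e assume e: "e \<in> {e \<in> edges G. v \<in> e}"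
      then have "{y \<in> verts G - {v}. y \<in> e} = e - {v}" using G by (auto simp: three_uniform_def)
      then show "card {y \<in> verts G - {v}. y \<in> e} = 2" using e G by (auto simp: three_uniform_def)
    qed
  qed (use G finite_edges[OF G] in \<open>auto simp: three_uniform_def\<close>)
  then show ?thesis by (simp add: pair_degree_def vertex_degree_def conj_assoc)
qed

section \<open>Vertices of large degree\<close>

text \<open>
  The greedy step: each vertex of \<open>A\<close> spoils at most as many edges at \<open>v\<close> as there are vertices in \<open>G\<close>.
\<close>

lemma edge_avoiding:
  assumes G: "three_uniform G" and A: "finite A" "v \<notin> A"
    and deg: "card A * card (verts G) < vertex_degree G v"
  obtains e where "e \<in> edges G" "v \<in> e" "e \<inter> A = {}"
proof (rule ccontr)
  assume "\<not> thesis"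
  then have "{e \<in> edges G. v \<in> e} \<subseteq> (\<Union>a\<in>A. {e \<in> edges G. {v, a} \<subseteq> e})" using that by blast
  then have "vertex_degree G v \<le> card (\<Union>a\<in>A. {e \<in> edges G. {v, a} \<subseteq> e})"
    unfolding vertex_degree_def by (intro card_mono) (use A finite_edges[OF G] in auto)
  also have "\<dots> \<le> (\<Sum>a\<in>A. pair_degree G {v, a})"
    unfolding pair_degree_def by (rule card_UN_le[OF A(1)])
  also have "\<dots> \<le> (\<Sum>a\<in>A. card (verts G))"
    by (intro sum_mono pair_degree_le_card_verts[OF G]) (use A in \<open>auto simp: card_2_iff\<close>)
  finally show False using deg by simp
qed

lemma card_Union_matching:
  assumes "three_uniform G" "M \<subseteq> edges G" "pairwise disjnt M" "finite M"
  shows "finite (\<Union>M)" "card (\<Union>M) = 3 * card M"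
proof -
  have M: "card e = 3" "finite e" if "e \<in> M" for e
    using assms that by (auto simp: three_uniform_def intro: finite_subset)
  then show "finite (\<Union>M)" using assms by auto
  show "card (\<Union>M) = 3 * card M" using M assms by (simp add: card_Union_disjoint)
qed

text \<open>
  The edges are chosen one heavy vertex at a time. An early edge must not use up a heavy vertex
  whose turn comes later, so the induction also maintains that the matching built for \<open>D\<close> meets \<open>B\<close>
  in \<open>D\<close> only. The set to avoid then has at most \<open>3 s\<close> vertices in earlier edges and at most \<open>s\<close> in
  \<open>B\<close>, which explains the threshold \<open>4 s n\<close>.
\<close>

lemma matching_from_heavy_vertices:
  assumes G: "three_uniform G" and B: "finite B" "card B \<le> s"
    and heavy: "\<And>v. v \<in> B \<Longrightarrow> 4 * s * card (verts G) < vertex_degree G v"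
  shows "\<exists>M. M \<subseteq> edges G \<and> pairwise disjnt M \<and> finite M \<and> card M = card B"
proof -
  have "\<exists>M. M \<subseteq> edges G \<and> pairwise disjnt M \<and> finite M \<and> card M = card D \<and> \<Union>M \<inter> B = D"
    if "D \<subseteq> B" for D
    using finite_subset[OF that B(1)] that
  proof (induction D rule: finite_induct)
    case empty
    show ?case by (intro exI[of _ "{}"]) auto
  next
    case (insert v D)
    then obtain M where M: "M \<subseteq> edges G" "pairwise disjnt M" "finite M" "card M = card D"
        "\<Union>M \<inter> B = D" by auto
    define A where "A = \<Union>M \<union> B - {v}"
    have "card A \<le> card (\<Union>M) + card B"
      unfolding A_def by (meson card_Diff1_le card_Un_le le_trans)
    also have "\<dots> = 3 * card D + card B" using card_Union_matching[OF G M(1-3)] M by simp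
    also have "card D \<le> card B" using insert.prems B by (intro card_mono) auto
    finally have "card A \<le> 4 * s" using B by simp
    then have "card A * card (verts G) \<le> 4 * s * card (verts G)" by (rule mult_le_mono1)
    also have "\<dots> < vertex_degree G v" using heavy insert.prems by auto
    finally obtain e where e: "e \<in> edges G" "v \<in> e" "e \<inter> A = {}"
      using edge_avoiding[OF G, of A v] B card_Union_matching(1)[OF G M(1-3)] by (auto simp: A_def)
    have v: "v \<notin> \<Union>M" using M(5) insert by auto
    have eB: "e \<inter> \<Union>M = {}" "e \<inter> B = {v}" "e \<notin> M" using e v insert.prems by (auto simp: A_def)
    have "pairwise disjnt (insert e M)" using M(2) eB(1) by (auto simp: pairwise_insert disjnt_iff)
    moreover have "\<Union>(insert e M) \<inter> B = insert v D" using M(5) eB(2) by auto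
    ultimately show ?case using M e(1) eB(3) insert.hyps
      by (intro exI[of _ "insert e M"]) auto
  qed
  from this[of B] show ?thesis by blast
qed

section \<open>The upper bound\<close>

text \<open>An edge missing all vertices of a maximal matching could be added to it.\<close>

lemma vertex_cover_of_matching_free:
  assumes G: "three_uniform G" and free: "hfree (matching3 s) G"
  obtains C where "finite C" "card C \<le> 3 * s" "C \<subseteq> verts G" "\<And>e. e \<in> edges G \<Longrightarrow> e \<inter> C \<noteq> {}"
proof -
  define X where "X = {M. M \<subseteq> edges G \<and> pairwise disjnt M}"
  have finX: "finite X" "{} \<in> X" using finite_edges[OF G] by (auto simp: X_def)
  have fE: "finite M'" if "M' \<in> X" for M'
    using that finite_edges[OF G] by (auto simp: X_def intro: finite_subset)
  obtain M where M: "M \<in> X" and mx: "\<And>M'. M' \<in> X \<Longrightarrow> \<not> M \<subset> M'"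
    using finite_has_maximal[of X] finX by (metis empty_iff order.strict_iff_order)
  have M': "M \<subseteq> edges G" "pairwise disjnt M" "finite M" using M fE[OF M] by (auto simp: X_def)
  have "card M < s"
  proof (rule ccontr)
    assume "\<not> card M < s"
    then obtain N where "N \<subseteq> M" "card N = s" using obtain_subset_with_card_n[of s M] by auto
    moreover from this M' have "N \<subseteq> edges G" "pairwise disjnt N" "finite N"
      by (auto intro: pairwise_subset finite_subset)
    ultimately show False using free contains_matching3_iff[OF G] by (auto simp: hfree_def)
  qed
  show ?thesis
  proof (rule that[of "\<Union>M"])
    show "finite (\<Union>M)" "card (\<Union>M) \<le> 3 * s"
      using card_Union_matching[OF G M'] \<open>card M < s\<close> by auto
    show "\<Union>M \<subseteq> verts G" using M' G by (auto simp: three_uniform_def)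
    fix e assume e: "e \<in> edges G"
    show "e \<inter> \<Union>M \<noteq> {}"
    proof
      assume disj: "e \<inter> \<Union>M = {}"
      have "e \<noteq> {}" using e G by (auto simp: three_uniform_def)
      then have "e \<notin> M" using disj by auto
      moreover have "insert e M \<in> X"
        using M' e disj by (auto simp: X_def pairwise_insert disjnt_iff)
      ultimately show False using mx[of "insert e M"] by auto
    qed
  qed
qed

text \<open>
  Only pairs meeting the cover \<open>C\<close> in a vertex of the heavy part \<open>B\<close> contribute to the cubic term.
  The constant \<open>33\<close> collects \<open>9 s\<^sup>2 = (3 s)\<^sup>2\<close> from the pairs outside \<open>C\<close> and \<open>24 s\<^sup>2 = 3 s * 8 s\<close> from
  the at most \<open>3 s\<close> light vertices of \<open>C\<close>.
\<close>

lemma co2_le_of_matching_free: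
  assumes G: "three_uniform G" and n: "card (verts G) = n" and free: "hfree (matching3 s) G"
  shows "co2 G \<le> (s - 1) * n ^ 3 + 33 * s\<^sup>2 * n\<^sup>2"
proof -
  let ?V = "verts G"
  let ?d = "pair_degree G"
  have fV: "finite ?V" using G by (simp add: three_uniform_def)
  obtain C where C: "finite C" "card C \<le> 3 * s" "C \<subseteq> ?V" "\<And>e. e \<in> edges G \<Longrightarrow> e \<inter> C \<noteq> {}"
    using vertex_cover_of_matching_free[OF G free] by blast
  define B where "B = {v \<in> C. 4 * s * n < vertex_degree G v}"
  have dn: "?d {c, y} \<le> n" if "y \<in> ?V - {c}" for c y
    using pair_degree_le_card_verts[OF G, of "{c, y}"] that n by (auto simp: card_2_iff)
  have B: "card B \<le> s - 1"
  proof (rule ccontr)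
    assume "\<not> card B \<le> s - 1"
    then have "s \<le> card B" by simp
    then obtain B' where B': "B' \<subseteq> B" "card B' = s" "finite B'"
      by (rule obtain_subset_with_card_n)
    then show False
      using matching_from_heavy_vertices[OF G, of B' s] free n
      by (auto simp: hfree_def contains_matching3_iff[OF G] B_def)
  qed
  \<comment> \<open>A pair inside \<open>C\<close> is counted by \<open>f\<close> at both of its vertices, which is harmless for an upper bound.\<close>
  define f where "f c = (\<Sum>y\<in>?V - {c}. (?d {c, y})\<^sup>2)" for c
  have heavy: "f c \<le> n ^ 3" for c
  proof -
    have "f c \<le> (\<Sum>y\<in>?V - {c}. n\<^sup>2)" unfolding f_def
      by (intro sum_mono power_mono dn) auto
    also have "\<dots> \<le> n * n\<^sup>2" using card_Diff1_le[of ?V c] n by simp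
    finally show ?thesis by (simp add: power3_eq_cube power2_eq_square)
  qed
  have light: "f c \<le> 8 * s * n\<^sup>2" if "c \<in> C - B" for c
  proof -
    have "f c \<le> (\<Sum>y\<in>?V - {c}. n * ?d {c, y})" unfolding f_def power2_eq_square
      by (intro sum_mono mult_le_mono1 dn) auto
    also have "\<dots> = n * (2 * vertex_degree G c)"
      by (simp add: sum_distrib_left[symmetric] sum_pair_degree[OF G])
    also have "\<dots> \<le> n * (2 * (4 * s * n))" using that by (intro mult_le_mono le_refl) (auto simp: B_def)
    finally show ?thesis by (simp add: power2_eq_square mult_ac)
  qed
  define P where "P = {p. p \<subseteq> ?V \<and> card p = 2}"
  have fP: "finite P" unfolding P_def using fV by auto
  have "card P = n choose 2" unfolding P_def using n_subsets[OF fV] n by simp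
  also have "\<dots> \<le> n\<^sup>2" by (simp add: choose_two power2_eq_square) (metis div_le_dividend diff_le_self le_trans mult_le_mono2)
  finally have cP: "card P \<le> n\<^sup>2" .
  have "(\<Sum>p | p \<in> P \<and> p \<inter> C = {}. (?d p)\<^sup>2) \<le> (\<Sum>p | p \<in> P \<and> p \<inter> C = {}. (3 * s)\<^sup>2)"
  proof (intro sum_mono power_mono)
    fix p assume p: "p \<in> {p. p \<in> P \<and> p \<inter> C = {}}"
    then have "?d p \<le> card C" using C(4)
      by (intro pair_degree_le[OF G _ C(1)]) (auto simp: P_def; blast)+
    then show "?d p \<le> 3 * s" using C(2) by simp
  qed simp
  also have "\<dots> \<le> n\<^sup>2 * (3 * s)\<^sup>2"
    using card_mono[of P "{p. p \<in> P \<and> p \<inter> C = {}}"] fP cP by (auto intro!: mult_le_mono1)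
  finally have off: "(\<Sum>p | p \<in> P \<and> p \<inter> C = {}. (?d p)\<^sup>2) \<le> 9 * s\<^sup>2 * n\<^sup>2"
    by (simp add: power_mult_distrib mult_ac)
  have "(\<Sum>p | p \<in> P \<and> p \<inter> C \<noteq> {}. (?d p)\<^sup>2)
      \<le> (\<Sum>p\<in>(\<lambda>(c, y). {c, y}) ` (SIGMA c:C. ?V - {c}). (?d p)\<^sup>2)"
  proof (rule sum_mono2)
    show "finite ((\<lambda>(c, y). {c, y}) ` (SIGMA c:C. ?V - {c}))" using C(1) fV by auto
    show "{p. p \<in> P \<and> p \<inter> C \<noteq> {}} \<subseteq> (\<lambda>(c, y). {c, y}) ` (SIGMA c:C. ?V - {c})"
    proof
      fix p assume p: "p \<in> {p. p \<in> P \<and> p \<inter> C \<noteq> {}}"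
      then obtain c where c: "c \<in> p" "c \<in> C" by auto
      moreover from p have "card p = 2" by (simp add: P_def)
      ultimately obtain y where y: "p = {c, y}" "y \<noteq> c" unfolding card_2_iff by auto
      then show "p \<in> (\<lambda>(c, y). {c, y}) ` (SIGMA c:C. ?V - {c})"
        using p c by (intro image_eqI[of _ _ "(c, y)"]) (auto simp: P_def)
    qed
  qed simp
  also have "\<dots> \<le> (\<Sum>(c, y)\<in>(SIGMA c:C. ?V - {c}). (?d {c, y})\<^sup>2)"
    using sum_image_le[of "SIGMA c:C. ?V - {c}" "\<lambda>p. (?d p)\<^sup>2" "\<lambda>(c, y). {c, y}"] C(1) fV
    by (simp add: o_def case_prod_unfold)
  also have "\<dots> = (\<Sum>c\<in>C. f c)"
    unfolding f_def using C(1) fV by (simp add: sum.Sigma)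
  also have "\<dots> = (\<Sum>c\<in>B. f c) + (\<Sum>c\<in>C - B. f c)"
    using C(1) by (intro sum.subset_diff[THEN trans[OF _ add.commute]]) (auto simp: B_def)
  also have "\<dots> \<le> (\<Sum>c\<in>B. n ^ 3) + (\<Sum>c\<in>C - B. 8 * s * n\<^sup>2)"
    by (intro add_mono sum_mono heavy light)
  also have "\<dots> = card B * n ^ 3 + card (C - B) * (8 * s * n\<^sup>2)" by simp
  also have "\<dots> \<le> (s - 1) * n ^ 3 + (3 * s) * (8 * s * n\<^sup>2)"
    using B C(2) card_mono[of C "C - B"] C(1) by (intro add_mono mult_le_mono1) auto
  finally have on: "(\<Sum>p | p \<in> P \<and> p \<inter> C \<noteq> {}. (?d p)\<^sup>2) \<le> (s - 1) * n ^ 3 + 24 * s\<^sup>2 * n\<^sup>2"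
    by (simp add: power2_eq_square mult_ac)
  have "co2 G = (\<Sum>p\<in>P. (?d p)\<^sup>2)" by (simp add: co2_def P_def)
  also have "\<dots> = (\<Sum>p | p \<in> P \<and> p \<inter> C = {}. (?d p)\<^sup>2) + (\<Sum>p | p \<in> P \<and> p \<inter> C \<noteq> {}. (?d p)\<^sup>2)"
    using fP by (subst sum.union_disjoint[symmetric]) (auto intro!: sum.cong)
  finally show ?thesis using off on by simp
qed

section \<open>The lower bound\<close>

definition edges_meeting :: "'a set \<Rightarrow> 'a set \<Rightarrow> 'a hypergraph" where
  "edges_meeting V S = (V, {e. e \<subseteq> V \<and> card e = 3 \<and> e \<inter> S \<noteq> {}})"

lemma three_uniform_edges_meeting: "finite V \<Longrightarrow> three_uniform (edges_meeting V S)"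
  by (auto simp: edges_meeting_def three_uniform_def)

text \<open>Choosing a vertex of \<open>S\<close> in each edge is injective on a matching.\<close>

lemma hfree_edges_meeting:
  assumes "finite V" "finite S" "card S < s"
  shows "hfree (matching3 s) (edges_meeting V S)"
proof -
  have False if M: "M \<subseteq> edges (edges_meeting V S)" "pairwise disjnt M" "card M = s" for M
  proof -
    have "\<forall>e\<in>M. \<exists>v. v \<in> e \<inter> S" using M(1) by (auto simp: edges_meeting_def)
    then obtain v where v: "\<And>e. e \<in> M \<Longrightarrow> v e \<in> e \<inter> S" by metis
    have "inj_on v M"
    proof (rule inj_onI)
      fix e e' assume e: "e \<in> M" "e' \<in> M" "v e = v e'"
      then have "\<not> disjnt e e'" using v[of e] v[of e'] by (auto simp: disjnt_def)
      then show "e = e'" using M(2) e by (auto simp: pairwise_def)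
    qed
    then have "card M \<le> card S" using v assms(2) by (intro card_inj_on_le[of v]) auto
    then show False using M(3) assms(3) by simp
  qed
  then show ?thesis
    unfolding hfree_def contains_matching3_iff[OF three_uniform_edges_meeting[OF assms(1)]] by blast
qed

lemma pair_degree_edges_meeting:
  assumes V: "finite V" and x: "x \<in> S" "x \<in> V" and y: "y \<in> V" "y \<noteq> x"
  shows "card V - 2 \<le> pair_degree (edges_meeting V S) {x, y}"
proof -
  have "card V - 2 = card (V - {x, y})" using assms by (subst card_Diff_subset) auto
  also have "\<dots> \<le> card {e \<in> edges (edges_meeting V S). {x, y} \<subseteq> e}"
  proof (rule card_inj_on_le[of "\<lambda>z. {x, y, z}"])
    show "inj_on (\<lambda>z. {x, y, z}) (V - {x, y})" by (auto simp: inj_on_def)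
    show "(\<lambda>z. {x, y, z}) ` (V - {x, y}) \<subseteq> {e \<in> edges (edges_meeting V S). {x, y} \<subseteq> e}"
      using assms by (auto simp: edges_meeting_def card_insert_if)
    show "finite {e \<in> edges (edges_meeting V S). {x, y} \<subseteq> e}"
      using finite_edges[OF three_uniform_edges_meeting[OF V]] by simp
  qed
  finally show ?thesis by (simp add: pair_degree_def)
qed

text \<open>
  Counting only the pairs with exactly one vertex in \<open>S\<close> suffices: the pairs inside \<open>S\<close> contribute
  \<open>O(n\<^sup>2)\<close>, and those outside have codegree \<open>card S\<close>.
\<close>

lemma co2_edges_meeting:
  assumes V: "finite V" and S: "S \<subseteq> V"
  shows "card S * (card V - card S) * (card V - 2)\<^sup>2 \<le> co2 (edges_meeting V S)"
proof -
  let ?G = "edges_meeting V S" and ?pair = "\<lambda>(x, y). {x, y}"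
  have "finite S" using S V by (rule finite_subset)
  have inj: "inj_on ?pair (S \<times> (V - S))" by (auto simp: inj_on_def doubleton_eq_iff)
  have "card S * (card V - card S) = card (S \<times> (V - S))"
    using V S \<open>finite S\<close> by (simp add: card_cartesian_product card_Diff_subset)
  then have "card S * (card V - card S) * (card V - 2)\<^sup>2 = (\<Sum>p\<in>S \<times> (V - S). (card V - 2)\<^sup>2)"
    by simp
  also have "\<dots> \<le> (\<Sum>p\<in>S \<times> (V - S). (pair_degree ?G (?pair p))\<^sup>2)"
    using S by (intro sum_mono power_mono) (auto intro!: pair_degree_edges_meeting[OF V])
  also have "\<dots> = (\<Sum>p\<in>?pair ` (S \<times> (V - S)). (pair_degree ?G p)\<^sup>2)"
    by (simp add: sum.reindex[OF inj])
  also have "\<dots> \<le> co2 ?G"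
    unfolding co2_def using V S
    by (intro sum_mono2) (auto simp: edges_meeting_def card_insert_if)
  finally show ?thesis .
qed

section \<open>The asymptotics\<close>

lemma exco2_matching3_le:
  assumes "s \<ge> 1"
  shows "exco2 n (matching3 s) \<le> (s - 1) * n ^ 3 + 33 * s\<^sup>2 * n\<^sup>2"
proof -
  have "edges (matching3 s) \<noteq> {}" using assms by (auto simp: matching3_def lessThan_empty_iff)
  then have "exco2 n (matching3 s) \<in> co2_values n (matching3 s)"
    unfolding exco2_def by (intro Max_in finite_co2_values co2_values_nonempty)
  then obtain G :: "nat hypergraph" where "exco2 n (matching3 s) = co2 G" "three_uniform G"
      "card (verts G) = n" "hfree (matching3 s) G"
    unfolding co2_values_def by blast
  then show ?thesis using co2_le_of_matching_free by metis
qed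

lemma le_exco2_matching3:
  assumes "s \<ge> 1" "n \<ge> s"
  shows "(s - 1) * (n - (s - 1)) * (n - 2)\<^sup>2 \<le> exco2 n (matching3 s)"
proof -
  let ?G = "edges_meeting {..<n} {..<s - 1}"
  have "three_uniform ?G" by (simp add: three_uniform_edges_meeting)
  moreover have "card (verts ?G) = n" by (simp add: edges_meeting_def)
  moreover have "hfree (matching3 s) ?G" using assms by (intro hfree_edges_meeting) auto
  ultimately have "co2 ?G \<in> co2_values n (matching3 s)" unfolding co2_values_def by blast
  then have "co2 ?G \<le> exco2 n (matching3 s)"
    unfolding exco2_def by (rule Max_ge[OF finite_co2_values])
  moreover have "{..<s - 1} \<subseteq> {..<n}" using assms by auto
  ultimately show ?thesis using co2_edges_meeting[of "{..<n}" "{..<s - 1}"] by simp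
qed

theorem theorem1p5:
  fixes s :: nat
  assumes "s \<ge> 2"
  shows "(\<lambda>n::nat. real (exco2 n (matching3 s))) \<sim>[at_top] (\<lambda>n. (real s - 1) * real n ^ 3)"
proof -
  define k where "k = real s - 1"
  have k: "k > 0" using assms by (simp add: k_def)
  show ?thesis
  proof (rule asymp_equiv_sandwich_real)
    show "(\<lambda>n. k * (real n - k) * (real n - 2)\<^sup>2) \<sim>[at_top] (\<lambda>n. (real s - 1) * real n ^ 3)"
      unfolding k_def[symmetric] using k by real_asymp
    show "(\<lambda>n. k * real n ^ 3 + 33 * (k + 1)\<^sup>2 * (real n)\<^sup>2) \<sim>[at_top]
        (\<lambda>n. (real s - 1) * real n ^ 3)"
      unfolding k_def[symmetric] using k by real_asymp
    show "\<forall>\<^sub>F n in at_top. real (exco2 n (matching3 s)) \<in>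
        {k * (real n - k) * (real n - 2)\<^sup>2..k * real n ^ 3 + 33 * (k + 1)\<^sup>2 * (real n)\<^sup>2}"
      using eventually_ge_at_top[of s]
    proof eventually_elim
      case (elim n)
      have "real (s - 1) = k" "real (n - (s - 1)) = real n - k" "real (n - 2) = real n - 2"
        "real s = k + 1"
        using assms elim by (auto simp: k_def of_nat_diff)
      note eqs = this
      have "real ((s - 1) * (n - (s - 1)) * (n - 2)\<^sup>2) \<le> real (exco2 n (matching3 s))"
        using le_exco2_matching3[of s n] assms elim by (intro of_nat_mono) simp
      moreover have "real (exco2 n (matching3 s)) \<le> real ((s - 1) * n ^ 3 + 33 * s\<^sup>2 * n\<^sup>2)"
        using exco2_matching3_le[of s n] assms by (intro of_nat_mono) simp
      ultimately show ?case
        by (simp only: of_nat_mult of_nat_add of_nat_power of_nat_numeral eqs atLeastAtMost_iff simp_thms)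
    qed
  qed
qed

end
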